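(* Let $\nu\in(0,1]$ and $\lambda>0$. For each $t>0$ let $A_{\nu,\lambda}(t)$ be a random variable with values in $\{0,1,2,\ldots\}$ such that $$P(A_{\nu,\lambda}(t)=k)=\frac{(\lambda t^\nu)^k}{\Gamma(\nu k+1)}\frac{1}{E_{\nu,1}(\lambda t^\nu)}\qquad\text{for all } k\in\{0,1,2,3,\ldots\}.$$ Then $\left\{\frac{A_{\nu,\lambda}(t)}{t}:t>0\right\}$ satisfies the large deviation principle (as $t\to\infty$, with speed $t$) with good rate function $I_{\nu,\lambda}^{(A)}$ defined by $$I_{\nu,\lambda}^{(A)}(x):=\begin{cases}\nu x\log\frac{\nu x}{\lambda^{1/\nu}}-\nu x+\lambda^{1/\nu}&\text{if } x\geq 0\\ \infty&\text{if } x<0.\end{cases}$$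
   Context: Mittag-Leffler function: $E_{\alpha,\beta}(x):=\sum_{r\geq 0}\frac{x^r}{\Gamma(\alpha r+\beta)}$. Convention: $0\log 0=0$. Large deviation principle (LDP): a family $\{Z_t:t>0\}$ of random variables with values in a topological space $\mathcal{Z}$ satisfies the LDP with rate function $I:\mathcal{Z}\to[0,\infty]$ if $I$ is lower semi-continuous, $\limsup_{t\to\infty}\frac{1}{t}\log P(Z_t\in C)\leq-\inf_{x\in C}I(x)$ for all closed sets $C$, and $\liminf_{t\to\infty}\frac{1}{t}\log P(Z_t\in G)\geq-\inf_{x\in G}I(x)$ for all open sets $G$. The rate function $I$ is good if all its level sets $\{x\in\mathcal{Z}:I(x)\leq\eta\}$, $\eta\geq 0$, are compact. Here $\mathcal{Z}=\mathbb{R}$. *)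

theory Defs
  imports "HOL-Probability.Probability"
begin

(* At poles of Gamma the library has Gamma = 0, so those terms vanish, in agreement with
   the usual convention 1 / Gamma = 0 there. *)
definition mittag_leffler :: "real \<Rightarrow> real \<Rightarrow> real \<Rightarrow> real" where
  "mittag_leffler \<alpha> \<beta> x = (\<Sum>r. x ^ r / Gamma (\<alpha> * real r + \<beta>))"

(* Logarithm of a probability, with log 0 = -\<infinity> (the library's real ln has ln 0 = 0). *)
definition log_prob :: "real \<Rightarrow> ereal" where
  "log_prob p = (if p = 0 then -\<infinity> else ereal (ln p))"

definition lower_semicontinuous :: "('z :: topological_space \<Rightarrow> ereal) \<Rightarrow> bool" where
  "lower_semicontinuous I \<longleftrightarrow> (\<forall>a. closed {x. I x \<le> a})"

(* The random variable Z t lives on its own probability space M t.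
   Infima over the empty set are \<infinity> in ereal. *)
definition satisfies_LDP ::
  "(real \<Rightarrow> 'w measure) \<Rightarrow> (real \<Rightarrow> 'w \<Rightarrow> 'z :: topological_space) \<Rightarrow> ('z \<Rightarrow> ereal) \<Rightarrow> bool" where
  "satisfies_LDP M Z I \<longleftrightarrow>
     (\<forall>t>0. prob_space (M t) \<and> Z t \<in> borel_measurable (M t)) \<and>
     (\<forall>x. 0 \<le> I x) \<and> lower_semicontinuous I \<and>
     (\<forall>C. closed C \<longrightarrow>
        Limsup at_top (\<lambda>t. ereal (1 / t) * log_prob (measure (M t) {\<omega> \<in> space (M t). Z t \<omega> \<in> C}))
          \<le> - (INF x\<in>C. I x)) \<and>
     (\<forall>G. open G \<longrightarrow>
        Liminf at_top (\<lambda>t. ereal (1 / t) * log_prob (measure (M t) {\<omega> \<in> space (M t). Z t \<omega> \<in> G}))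
          \<ge> - (INF x\<in>G. I x))"

definition good_rate_function :: "('z :: topological_space \<Rightarrow> ereal) \<Rightarrow> bool" where
  "good_rate_function I \<longleftrightarrow> (\<forall>\<eta>::real. 0 \<le> \<eta> \<longrightarrow> compact {x. I x \<le> ereal \<eta>})"

(* At x = 0 the convention 0 * log 0 = 0 holds because the first factor is 0. *)
definition rate_A :: "real \<Rightarrow> real \<Rightarrow> real \<Rightarrow> ereal" where
  "rate_A \<nu> lam x =
     (if x \<ge> 0
      then ereal (\<nu> * x * ln (\<nu> * x / lam powr (1 / \<nu>)) - \<nu> * x + lam powr (1 / \<nu>))
      else \<infinity>)"

end

theory Submission
  imports Defs "HOL-Real_Asymp.Real_Asymp"
begin

text \<open>
  Put \<open>m = \<lambda>\<^bsup>1/\<nu>\<^esup>\<close>, so that the weights are \<open>w t k = (m t)\<^bsup>\<nu> k\<^esup> / \<Gamma>(\<nu> k + 1)\<close>. Restricting the Gamma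
  integral to \<open>[z, \<infinity>)\<close> gives \<open>z\<^sup>y \<le> e\<^sup>z \<Gamma>(y + 1)\<close> for all \<open>z > 0\<close>. The choice \<open>z = y\<close> yields
  \<open>w t k \<le> exp (t (m - I(k/t)))\<close>, which is exponentially sharp but not uniformly summable, and
  \<open>z = 2 m t\<close> yields a crude bound that is geometric in \<open>k\<close>. A geometric mean of the two with
  exponents \<open>1 - \<delta>\<close> and \<open>\<delta>\<close> is summable with exponential loss \<open>O(\<delta>)\<close>; this bounds the
  probability of any set on which \<open>I \<ge> J\<close> and, with \<open>J = 0\<close>, the normalising constant.
  The matching lower bounds come from the single term \<open>k = \<lfloor>x t\<rfloor>\<close> and an upper bound
  on \<open>\<Gamma>\<close>.
\<close>

section \<open>Lower and upper bounds on the Gamma function\<close>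

lemma powr_le_exp_mult_Gamma:
  fixes z y :: real
  assumes "0 < z" "0 \<le> y"
  shows "z powr y \<le> exp z * Gamma (y + 1)"
proof -
  have "((\<lambda>x. z powr y * exp (-1 * x)) has_integral z powr y * (exp (-1 * z) / 1)) {z..}"
    by (intro has_integral_mult_right has_integral_exp_minus_to_infinity) auto
  then have 1: "((\<lambda>x. if x \<in> {z..} then z powr y * exp (-1 * x) else 0)
      has_integral z powr y * (exp (-1 * z) / 1)) {0..}"
    using assms by (subst has_integral_restrict) auto
  have 2: "((\<lambda>x. x powr (y + 1 - 1) / exp x) has_integral Gamma (y + 1)) {0..}"
    using Gamma_integral_real[of "y + 1"] assms by simp
  have "z powr y * (exp (-1 * z) / 1) \<le> Gamma (y + 1)"
    using assms by (intro has_integral_le[OF 1 2])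
      (auto simp: exp_minus divide_inverse intro!: mult_right_mono powr_mono2)
  then show ?thesis
    by (simp add: exp_minus field_simps)
qed

text \<open>For \<open>y > 0\<close> this exceeds the lower bound from
  \<open>powr_le_exp_mult_Gamma\<close> at \<open>z = y\<close> only by a factor of polynomial size,
  which disappears under \<open>ln\<close> and division by \<open>t\<close>.\<close>

lemma Gamma_le_powr_mult_exp:
  fixes y :: real
  assumes "0 \<le> y"
  shows "Gamma (y + 1) \<le> (y + 1) powr (y + 1) * exp (- y)"
proof -
  \<comment> \<open>Leave a factor \<open>exp (- d x)\<close> for integrability and maximise the rest over \<open>x\<close>.\<close>
  define d where "d = 1 / (y + 1)"
  have d: "0 < d" using assms by (simp add: d_def)
  have 1: "((\<lambda>x. x powr (y + 1 - 1) / exp x) has_integral Gamma (y + 1)) {0..}"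
    using Gamma_integral_real[of "y + 1"] assms by simp
  have 2: "((\<lambda>x. (y + 1) powr y * exp (- y) * exp (- d * x)) has_integral
      (y + 1) powr y * exp (- y) * (exp (- d * 0) / d)) {0..}"
    by (intro has_integral_mult_right has_integral_exp_minus_to_infinity d)
  have "Gamma (y + 1) \<le> (y + 1) powr y * exp (- y) * (exp (- d * 0) / d)"
  proof (rule has_integral_le[OF 1 2])
    fix x :: real assume "x \<in> {0..}"
    show "x powr (y + 1 - 1) / exp x \<le> (y + 1) powr y * exp (- y) * exp (- d * x)"
    \<comment> \<open>At \<open>x = 0\<close> the left side is 0, also for \<open>y = 0\<close>,
      because \<open>0 powr 0 = 0\<close>.\<close>
    proof (cases "x = 0")
      case False
      with \<open>x \<in> {0..}\<close> have x: "0 < x" by simp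
      \<comment> \<open>Since \<open>1 - d = y / (y + 1)\<close>, the expression
        \<open>y * ln x - (1 - d) * x\<close> is maximal at \<open>x = y + 1\<close>, where this
        tangent bound is sharp.\<close>
      have "ln (x / (y + 1)) \<le> x / (y + 1) - 1"
        using x assms by (intro ln_le_minus_one) auto
      then have "y * (ln x - ln (y + 1)) \<le> y * (x / (y + 1) - 1)"
        using x assms by (intro mult_left_mono) (auto simp: ln_div)
      also have "\<dots> = x - d * x - y"
        using assms by (simp add: d_def field_simps)
      finally have "exp (y * ln x - x) \<le> exp (y * ln (y + 1) - y - d * x)"
        by (simp add: algebra_simps)
      then show ?thesis
        using x assms by (simp add: powr_def exp_diff exp_minus exp_add field_simps)
    qed simp
  qed
  also have "\<dots> = (y + 1) powr (y + 1) * exp (- y)"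
    using assms by (simp add: d_def powr_add)
  finally show ?thesis .
qed

lemma floor_mult_over_tendsto:
  fixes x :: real
  shows "((\<lambda>t. real_of_int \<lfloor>x * t\<rfloor> / t) \<longlongrightarrow> x) at_top"
proof (rule tendsto_sandwich)
  show "\<forall>\<^sub>F t in at_top. x - 1 / t \<le> real_of_int \<lfloor>x * t\<rfloor> / t"
    using eventually_gt_at_top[of 0]
  proof eventually_elim
    case (elim t)
    have "(x * t - 1) / t \<le> real_of_int \<lfloor>x * t\<rfloor> / t"
      using elim by (intro divide_right_mono) linarith+
    then show ?case using elim by (simp add: diff_divide_distrib)
  qed
  show "\<forall>\<^sub>F t in at_top. real_of_int \<lfloor>x * t\<rfloor> / t \<le> x"
    using eventually_gt_at_top[of 0] by eventually_elim (simp add: pos_divide_le_eq)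
  show "((\<lambda>t. x - 1 / t) \<longlongrightarrow> x) at_top" by real_asymp
qed simp

section \<open>The weights and their normalisation\<close>

locale mittag_leffler_family =
  fixes \<nu> lam :: real and M :: "real \<Rightarrow> 'w measure" and A :: "real \<Rightarrow> 'w \<Rightarrow> nat"
  assumes nu_pos: "0 < \<nu>" and lam_pos: "0 < lam"
    and prob_space_M: "0 < t \<Longrightarrow> prob_space (M t)"
    and A_measurable: "0 < t \<Longrightarrow> A t \<in> measurable (M t) (count_space UNIV)"
    and prob_A_eq: "0 < t \<Longrightarrow>
           measure (M t) {\<omega> \<in> space (M t). A t \<omega> = k} =
             (lam * t powr \<nu>) ^ k / Gamma (\<nu> * real k + 1)
               * (1 / mittag_leffler \<nu> 1 (lam * t powr \<nu>))"
begin

definition m :: real where "m = lam powr (1 / \<nu>)"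

definition w :: "real \<Rightarrow> nat \<Rightarrow> real" where
  "w t k = (m * t) powr (\<nu> * real k) / Gamma (\<nu> * real k + 1)"

text \<open>By \<open>w_eq\<close>, for \<open>t > 0\<close> this is the Mittag-Leffler value that
  normalises the law of \<open>A t\<close>.\<close>

definition E :: "real \<Rightarrow> real" where "E t = (\<Sum>k. w t k)"

text \<open>The rate function of the Poisson law with mean \<open>m\<close>, evaluated at
  \<open>\<nu> * x\<close>; on \<open>x \<ge> 0\<close> it vanishes at
  \<open>m / \<nu>\<close>.\<close>

definition f :: "real \<Rightarrow> real" where "f x = \<nu> * x * ln (\<nu> * x / m) - \<nu> * x + m"

lemma m_pos: "0 < m"
  using lam_pos by (simp add: m_def)

lemma rate_A_eq: "rate_A \<nu> lam x = (if 0 \<le> x then ereal (f x) else \<infinity>)"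
  by (simp add: rate_A_def f_def m_def)

lemma w_eq:
  assumes "0 < t"
  shows "(lam * t powr \<nu>) ^ k / Gamma (\<nu> * real k + 1) = w t k"
proof -
  have "lam * t powr \<nu> = (m * t) powr \<nu>"
    using assms lam_pos nu_pos by (simp add: m_def powr_mult powr_powr)
  moreover have "((m * t) powr \<nu>) ^ k = (m * t) powr (\<nu> * real k)"
    using assms m_pos by (simp add: powr_powr flip: powr_realpow)
  ultimately show ?thesis by (simp add: w_def)
qed

lemma w_pos: "0 < t \<Longrightarrow> 0 < w t k"
  using m_pos nu_pos by (simp add: w_def add_nonneg_pos Gamma_real_pos)

lemma w_0: "0 < t \<Longrightarrow> w t 0 = 1"
  using m_pos by (simp add: w_def)

lemma prob_eq:
  assumes "0 < t"
  shows "measure (M t) {\<omega> \<in> space (M t). A t \<omega> = k} = w t k / E t"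
  using prob_A_eq[OF assms] w_eq[OF assms] by (simp add: mittag_leffler_def E_def)

section \<open>The rate function: closed and compact sublevel sets\<close>

text \<open>The left side is the tangent to the convex function \<open>f\<close> at
  \<open>x = z / \<nu>\<close>. The inequality amounts to \<open>ln u \<le> u - 1\<close> at
  \<open>u = z / (\<nu> * x)\<close>; at \<open>x = 0\<close> it reads
  \<open>m - z \<le> m\<close>.\<close>

lemma affine_le_f:
  assumes "0 \<le> x" "0 < z"
  shows "\<nu> * x * ln (z / m) - z + m \<le> f x"
proof (cases "x = 0")
  case False
  then have y: "0 < \<nu> * x" using assms nu_pos by simp
  have "ln (z / (\<nu> * x)) \<le> z / (\<nu> * x) - 1"
    using y assms by (intro ln_le_minus_one) simp
  then have "\<nu> * x * (ln z - ln (\<nu> * x)) \<le> \<nu> * x * (z / (\<nu> * x) - 1)"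
    using y False assms nu_pos by (intro mult_left_mono) (auto simp: ln_div)
  also have "\<dots> = z - \<nu> * x" using False nu_pos by (simp add: field_simps)
  finally show ?thesis
    using False nu_pos assms m_pos by (simp add: f_def ln_div algebra_simps)
qed (use assms in \<open>simp add: f_def\<close>)

lemma f_nonneg: "0 \<le> x \<Longrightarrow> 0 \<le> f x"
  using affine_le_f[of x m] m_pos by simp

text \<open>A supremum of affine functions, hence closed sublevel sets without a separate treatment of
  the point \<open>0\<close>.\<close>

lemma f_le_iff:
  assumes "0 \<le> x"
  shows "f x \<le> a \<longleftrightarrow> (\<forall>z>0. \<nu> * x * ln (z / m) - z + m \<le> a)"
proof
  assume "f x \<le> a"
  then show "\<forall>z>0. \<nu> * x * ln (z / m) - z + m \<le> a"
    using affine_le_f[OF assms] by (meson order_trans)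
next
  assume *: "\<forall>z>0. \<nu> * x * ln (z / m) - z + m \<le> a"
  show "f x \<le> a"
  proof (cases "x = 0")
    case True
    \<comment> \<open>At \<open>x = 0\<close> no \<open>z > 0\<close> attains the supremum
      \<open>m\<close>; it is approached by \<open>z = e\<close> with \<open>e\<close> tending to 0.
      For \<open>x > 0\<close> it is attained at \<open>z = \<nu> * x\<close>.\<close>
    have "m \<le> a + e" if "0 < e" for e
      using *[rule_format, OF that] True by simp
    then have "m \<le> a" by (rule field_le_epsilon)
    then show ?thesis using True by (simp add: f_def)
  next
    case False
    then show ?thesis using *[rule_format, of "\<nu> * x"] assms nu_pos by (simp add: f_def)
  qed
qed

lemma closed_sublevel: "closed {x. rate_A \<nu> lam x \<le> ereal a}"
proof -
  have "{x. rate_A \<nu> lam x \<le> ereal a} =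
      {0..} \<inter> (\<Inter>z\<in>{0<..}. {x. \<nu> * x * ln (z / m) - z + m \<le> a})"
    by (auto simp: rate_A_eq f_le_iff)
  also have "closed \<dots>"
    by (intro closed_Int closed_INT closed_atLeast ballI closed_Collect_le continuous_intros)
  finally show ?thesis .
qed

lemma lower_semicontinuous_rate: "lower_semicontinuous (rate_A \<nu> lam)"
  unfolding lower_semicontinuous_def
proof
  fix a :: ereal
  show "closed {x. rate_A \<nu> lam x \<le> a}"
  proof (cases a)
    case MInf
    then have "{x. rate_A \<nu> lam x \<le> a} = {}" by (auto simp: rate_A_eq)
    then show ?thesis by simp
  qed (use closed_sublevel in auto)
qed

lemma good_rate: "good_rate_function (rate_A \<nu> lam)"
  unfolding good_rate_function_def
proof (intro allI impI)
  fix \<eta> :: real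
  have "{x. rate_A \<nu> lam x \<le> ereal \<eta>} \<subseteq> {0..(\<eta> + exp 1 * m) / \<nu>}"
  proof
    fix x assume "x \<in> {x. rate_A \<nu> lam x \<le> ereal \<eta>}"
    then have x: "0 \<le> x" "f x \<le> \<eta>" by (auto simp: rate_A_eq split: if_splits)
    \<comment> \<open>With \<open>z = exp 1 * m\<close> the logarithm is 1, so this tangent has the
      positive slope \<nu> and bounds \<open>x\<close> in terms of \<eta>.\<close>
    have "\<nu> * x * ln (exp 1 * m / m) - exp 1 * m + m \<le> f x"
      using m_pos x by (intro affine_le_f) auto
    then show "x \<in> {0..(\<eta> + exp 1 * m) / \<nu>}"
      using x m_pos nu_pos by (simp add: field_simps)
  qed
  then have "bounded {x. rate_A \<nu> lam x \<le> ereal \<eta>}"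
    using bounded_closed_interval bounded_subset by blast
  with closed_sublevel show "compact {x. rate_A \<nu> lam x \<le> ereal \<eta>}"
    by (simp add: compact_eq_bounded_closed)
qed

section \<open>Upper bounds on weights, normaliser and probabilities\<close>

lemma w_le_exp_powr:
  assumes "0 < t" "0 < z"
  shows "w t k \<le> exp z * (m * t / z) powr (\<nu> * real k)"
proof -
  have y: "0 \<le> \<nu> * real k" using nu_pos by simp
  have "w t k * z powr (\<nu> * real k) \<le> w t k * (exp z * Gamma (\<nu> * real k + 1))"
    using w_pos assms y by (intro mult_left_mono powr_le_exp_mult_Gamma) (auto intro: less_imp_le)
  also have "\<dots> = exp z * (m * t) powr (\<nu> * real k)"
    using y less_imp_neq[OF Gamma_real_pos[of "\<nu> * real k + 1"]] by (simp add: w_def)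
  finally show ?thesis
    using assms m_pos by (simp add: powr_divide field_simps)
qed

lemma w_le_exp_f:
  assumes "0 < t"
  shows "w t k \<le> exp (t * (m - f (real k / t)))"
\<comment> \<open>The choice \<open>z = \<nu> * real k\<close> must be positive, so
  \<open>k = 0\<close> is separate; there both sides are 1.\<close>
proof (cases "k = 0")
  case True
  then show ?thesis using assms by (simp add: w_0 f_def)
next
  case False
  define y where "y = \<nu> * real k"
  have y: "0 < y" using False nu_pos by (simp add: y_def)
  have "w t k \<le> exp y * (m * t / y) powr y"
    using w_le_exp_powr[OF assms y] by (simp add: y_def)
  also have "\<dots> = exp (y - y * ln (y / (m * t)))"
    using y assms m_pos by (simp add: powr_def ln_div ln_mult flip: exp_add) (simp add: algebra_simps)
  also have "y - y * ln (y / (m * t)) = t * (m - f (real k / t))"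
    using assms m_pos by (simp add: f_def y_def field_simps)
  finally show ?thesis .
qed

text \<open>The exponent equals \<open>m - J + \<delta> * (m + J)\<close>: any \<delta> > 0 buys
  geometric decay in \<open>k\<close>, at a cost that vanishes with \<delta>.\<close>

lemma w_le_geometric:
  assumes "0 < t" "0 \<le> \<delta>" "\<delta> \<le> 1" "J \<le> f (real k / t)"
  shows "w t k \<le> exp (t * ((1 - \<delta>) * (m - J) + 2 * m * \<delta>)) * (2 powr - (\<nu> * \<delta>)) ^ k"
proof -
  have 1: "w t k \<le> exp (t * (m - J))"
    using w_le_exp_f[OF assms(1), of k] assms by (smt (verit) exp_le_cancel_iff mult_left_mono)
  \<comment> \<open>\<open>z = 2 * m * t\<close> makes the base \<open>m * t / z\<close> equal to
    1/2.\<close>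
  have 2: "w t k \<le> exp (2 * m * t) * 2 powr (- (\<nu> * real k))"
    using w_le_exp_powr[OF assms(1), of "2 * m * t" k] assms m_pos
    by (simp add: powr_minus powr_divide field_simps)
  have "w t k = w t k powr (1 - \<delta>) * w t k powr \<delta>"
    using w_pos[OF assms(1), of k] by (simp flip: powr_add)
  also have "\<dots> \<le> exp (t * (m - J)) powr (1 - \<delta>) *
      (exp (2 * m * t) * 2 powr (- (\<nu> * real k))) powr \<delta>"
    using 1 2 w_pos[OF assms(1), of k] assms by (intro mult_mono powr_mono2) auto
  also have "\<dots> = exp (t * ((1 - \<delta>) * (m - J) + 2 * m * \<delta>)) * (2 powr - (\<nu> * \<delta>)) ^ k"
    by (simp add: powr_def ln_mult flip: exp_add exp_of_nat_mult) (simp add: algebra_simps)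
  finally show ?thesis .
qed

lemma q_bounds:
  assumes "0 < \<delta>"
  shows "0 \<le> 2 powr - (\<nu> * \<delta>)" "2 powr - (\<nu> * \<delta>) < (1 :: real)"
  using assms nu_pos by (auto simp: powr_less_one)

lemma summable_w:
  assumes "0 < t"
  shows "summable (w t)"
proof (rule summable_comparison_test')
  \<comment> \<open>\<delta> = 1 keeps only the crude geometric bound, which is enough for
    convergence.\<close>
  show "summable (\<lambda>k. exp (t * ((1 - 1) * (m - 0) + 2 * m * 1)) * (2 powr - (\<nu> * 1)) ^ k)"
    using q_bounds[of 1] by (intro summable_mult summable_geometric) auto
  show "norm (w t k) \<le> exp (t * ((1 - 1) * (m - 0) + 2 * m * 1)) * (2 powr - (\<nu> * 1)) ^ k" for k
    using w_le_geometric[of t 1 0 k] assms w_pos[of t k] f_nonneg by simp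
qed

lemma w_le_E: "0 < t \<Longrightarrow> w t k \<le> E t"
  unfolding E_def using sum_le_suminf[OF summable_w, of t "{k}"] w_pos[of t]
  by (simp add: less_imp_le)

lemma E_pos: "0 < t \<Longrightarrow> 0 < E t"
  using w_le_E[of t 0] w_pos[of t 0] by linarith

lemma E_le:
  assumes "0 < t" "0 < \<delta>" "\<delta> \<le> 1"
  shows "E t \<le> exp (t * (m + m * \<delta>)) / (1 - 2 powr - (\<nu> * \<delta>))"
proof -
  have "E t \<le> (\<Sum>k. exp (t * ((1 - \<delta>) * (m - 0) + 2 * m * \<delta>)) * (2 powr - (\<nu> * \<delta>)) ^ k)"
    unfolding E_def using q_bounds[OF assms(2)] assms f_nonneg
    by (intro suminf_le w_le_geometric summable_w summable_mult summable_geometric) auto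
  also have "\<dots> = exp (t * ((1 - \<delta>) * (m - 0) + 2 * m * \<delta>)) * (1 / (1 - 2 powr - (\<nu> * \<delta>)))"
    using q_bounds[OF assms(2)] by (subst suminf_mult) (auto simp: suminf_geometric)
  finally show ?thesis by (simp add: algebra_simps)
qed

lemma prob_le:
  assumes "0 < t" "0 < \<delta>" "\<delta> \<le> 1" "\<And>k. k \<in> S \<Longrightarrow> J \<le> f (real k / t)"
  shows "measure (M t) {\<omega> \<in> space (M t). A t \<omega> \<in> S} \<le>
    exp (t * ((1 - \<delta>) * (m - J) + 2 * m * \<delta>)) / (1 - 2 powr - (\<nu> * \<delta>)) / E t"
proof -
  interpret prob_space "M t" using assms prob_space_M by simp
  have [measurable]: "A t \<in> measurable (M t) (count_space UNIV)" using assms A_measurable by simp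
  \<comment> \<open>These events are empty for \<open>k\<close> outside \<open>S\<close>, so the
    series runs over all naturals and compares termwise with a full geometric series.\<close>
  let ?B = "\<lambda>k. {\<omega> \<in> space (M t). A t \<omega> = k \<and> k \<in> S}"
  let ?g = "\<lambda>k. exp (t * ((1 - \<delta>) * (m - J) + 2 * m * \<delta>)) / E t * (2 powr - (\<nu> * \<delta>)) ^ k"
  have "(\<lambda>k. measure (M t) (?B k)) sums measure (M t) (\<Union>k. ?B k)"
    by (intro finite_measure_UNION) (auto simp: disjoint_family_on_def)
  also have "(\<Union>k. ?B k) = {\<omega> \<in> space (M t). A t \<omega> \<in> S}" by auto
  finally have 1: "(\<lambda>k. measure (M t) (?B k)) sums measure (M t) {\<omega> \<in> space (M t). A t \<omega> \<in> S}" .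
  have 2: "?g sums (exp (t * ((1 - \<delta>) * (m - J) + 2 * m * \<delta>)) / E t * (1 / (1 - 2 powr - (\<nu> * \<delta>))))"
    using q_bounds[OF assms(2)] by (intro sums_mult geometric_sums) auto
  have "measure (M t) (?B k) \<le> ?g k" for k
  proof (cases "k \<in> S")
    case True
    then have "measure (M t) (?B k) = w t k / E t" using prob_eq[OF assms(1)] by simp
    also have "\<dots> \<le> exp (t * ((1 - \<delta>) * (m - J) + 2 * m * \<delta>)) * (2 powr - (\<nu> * \<delta>)) ^ k / E t"
      using True assms E_pos[OF assms(1)] by (intro divide_right_mono w_le_geometric) auto
    finally show ?thesis by simp
  qed (use E_pos[OF assms(1)] in simp)
  from sums_le[OF this 1 2] show ?thesis by (simp add: field_simps)
qed

section \<open>Lower bound on a single weight and growth of the normaliser\<close>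

text \<open>The upper bound on Gamma gives an explicit minorant \<open>h\<close>. Only its limit
  matters later: at \<open>x = m / \<nu>\<close> for the normaliser, at a point of an open set for
  the LDP.\<close>

lemma ln_w_floor_lower:
  assumes "0 < x"
  shows "\<exists>h. (h \<longlongrightarrow> m - f x) at_top \<and> (\<forall>\<^sub>F t in at_top. h t \<le> ln (w t (nat \<lfloor>x * t\<rfloor>)) / t)"
proof -
  define g where "g t = \<nu> * real (nat \<lfloor>x * t\<rfloor>) / t" for t
  have g: "(g \<longlongrightarrow> \<nu> * x) at_top"
  proof -
    have "((\<lambda>t. \<nu> * (real_of_int \<lfloor>x * t\<rfloor> / t)) \<longlongrightarrow> \<nu> * x) at_top"
      by (intro tendsto_mult_left floor_mult_over_tendsto)
    moreover have "\<forall>\<^sub>F t in at_top. \<nu> * (real_of_int \<lfloor>x * t\<rfloor> / t) = g t"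
      using eventually_gt_at_top[of 0] by eventually_elim (use assms in \<open>simp add: g_def\<close>)
    ultimately show ?thesis by (rule Lim_transform_eventually)
  qed
  have inv: "((\<lambda>t::real. 1 / t) \<longlongrightarrow> 0) at_top" by real_asymp
  have lninv: "((\<lambda>t::real. ln t / t) \<longlongrightarrow> 0) at_top" by real_asymp
  \<comment> \<open>The logarithm of the bound at \<open>y = t * g t\<close>, divided by
    \<open>t\<close>, with \<open>ln (y + 1) = ln t + ln (g t + 1 / t)\<close>; the terms
    \<open>g t * ln t\<close> cancel.\<close>
  let ?h = "\<lambda>t. g t * (ln m - ln (g t + 1 / t) + 1) - (ln t / t + ln (g t + 1 / t) * (1 / t))"
  \<comment> \<open>The logarithm needs a nonzero limit; the summand 0 is the limit of
    \<open>1 / t\<close>, kept to match the shape built by \<open>tendsto_intros\<close>.\<close>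
  have nx: "\<nu> * x + 0 \<noteq> 0" using assms nu_pos by simp
  have "(?h \<longlongrightarrow> \<nu> * x * (ln m - ln (\<nu> * x + 0) + 1) - (0 + ln (\<nu> * x + 0) * 0)) at_top"
    by (intro tendsto_intros g inv lninv nx)
  also have "\<nu> * x * (ln m - ln (\<nu> * x + 0) + 1) - (0 + ln (\<nu> * x + 0) * 0) = m - f x"
    using assms nu_pos m_pos by (simp add: f_def ln_div algebra_simps)
  finally have "(?h \<longlongrightarrow> m - f x) at_top" .
  moreover have "\<forall>\<^sub>F t in at_top. ?h t \<le> ln (w t (nat \<lfloor>x * t\<rfloor>)) / t"
    using eventually_gt_at_top[of 0]
  proof eventually_elim
    case (elim t)
    define y where "y = \<nu> * real (nat \<lfloor>x * t\<rfloor>)"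
    have y: "0 \<le> y" using nu_pos by (simp add: y_def)
    have gt: "g t = y / t" by (simp add: g_def y_def)
    have "ln (g t + 1 / t) = ln ((y + 1) / t)" by (simp add: gt add_divide_distrib)
    also have "\<dots> = ln (y + 1) - ln t" using y elim by (simp add: ln_div)
    finally have l: "ln (g t + 1 / t) = ln (y + 1) - ln t" .
    have "ln (Gamma (y + 1)) \<le> ln ((y + 1) powr (y + 1) * exp (- y))"
      using Gamma_le_powr_mult_exp[OF y] y by (subst ln_le_cancel_iff) (auto simp: Gamma_real_pos)
    also have "\<dots> = (y + 1) * ln (y + 1) - y"
      using y by (simp add: ln_mult ln_powr)
    finally have "y * (ln m + ln t) - ((y + 1) * ln (y + 1) - y) \<le> y * (ln m + ln t) - ln (Gamma (y + 1))"
      by simp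
    also have "\<dots> = ln (w t (nat \<lfloor>x * t\<rfloor>))"
      using y elim m_pos less_imp_neq[OF Gamma_real_pos[of "y + 1"]]
      by (simp add: w_def ln_div ln_powr ln_mult flip: y_def)
    finally have "(y * (ln m + ln t) - ((y + 1) * ln (y + 1) - y)) / t \<le> ln (w t (nat \<lfloor>x * t\<rfloor>)) / t"
      using elim by (intro divide_right_mono) auto
    also have "(y * (ln m + ln t) - ((y + 1) * ln (y + 1) - y)) / t = ?h t"
      unfolding l using elim by (simp add: gt field_simps)
    finally show ?case .
  qed
  ultimately show ?thesis by blast
qed

text \<open>From below, the single term near the zero \<open>m / \<nu>\<close> of \<open>f\<close>
  already grows at rate \<open>m\<close>; from above, \<open>E_le\<close> gives
  \<open>m + m * \<delta>\<close> for small \<delta>.\<close>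

lemma ln_E_asymp: "((\<lambda>t. ln (E t) / t) \<longlongrightarrow> m) at_top"
proof (rule order_tendstoI)
  fix a assume "a < m"
  have mn: "0 < m / \<nu>" using m_pos nu_pos by simp
  obtain h where h: "(h \<longlongrightarrow> m - f (m / \<nu>)) at_top"
      "\<forall>\<^sub>F t in at_top. h t \<le> ln (w t (nat \<lfloor>m / \<nu> * t\<rfloor>)) / t"
    using ln_w_floor_lower[OF mn] by blast
  have "m - f (m / \<nu>) = m" using m_pos nu_pos by (simp add: f_def)
  with h(1) \<open>a < m\<close> have "\<forall>\<^sub>F t in at_top. a < h t"
    by (metis order_tendstoD(1))
  with h(2) eventually_gt_at_top[of 0] show "\<forall>\<^sub>F t in at_top. a < ln (E t) / t"
  proof eventually_elim
    case (elim t)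
    have "ln (w t (nat \<lfloor>m / \<nu> * t\<rfloor>)) / t \<le> ln (E t) / t"
      using w_le_E w_pos E_pos elim by (intro divide_right_mono) auto
    with elim show ?case by linarith
  qed
next
  fix a assume "m < a"
  \<comment> \<open>Chosen so that \<open>m * \<delta>\<close> is at most half the gap
    \<open>a - m\<close>, and capped at 1 for \<open>E_le\<close>.\<close>
  define \<delta> where "\<delta> = min 1 ((a - m) / (2 * m))"
  have \<delta>: "0 < \<delta>" "\<delta> \<le> 1" using \<open>m < a\<close> m_pos by (auto simp: \<delta>_def)
  have "m * \<delta> \<le> m * ((a - m) / (2 * m))"
    unfolding \<delta>_def using m_pos by (intro mult_left_mono) auto
  also have "\<dots> = (a - m) / 2" using m_pos by simp
  finally have lt: "m + m * \<delta> < a" using \<open>m < a\<close> by simp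
  define q where "q = 1 - 2 powr - (\<nu> * \<delta>)"
  have q: "0 < q" using q_bounds[OF \<delta>(1)] by (simp add: q_def)
  have "((\<lambda>t. m + m * \<delta> - ln q / t) \<longlongrightarrow> m + m * \<delta>) at_top" by real_asymp
  then have "\<forall>\<^sub>F t in at_top. m + m * \<delta> - ln q / t < a"
    using lt by (rule order_tendstoD)
  with eventually_gt_at_top[of 0] show "\<forall>\<^sub>F t in at_top. ln (E t) / t < a"
  proof eventually_elim
    case (elim t)
    have "ln (E t) \<le> ln (exp (t * (m + m * \<delta>)) / q)"
      using E_le[OF elim(1) \<delta>] E_pos[OF elim(1)] q
      by (subst ln_le_cancel_iff) (auto simp: q_def)
    also have "\<dots> = t * (m + m * \<delta>) - ln q" using q by (simp add: ln_div)
    finally have "ln (E t) / t \<le> (t * (m + m * \<delta>) - ln q) / t"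
      using elim by (intro divide_right_mono) auto
    also have "\<dots> = m + m * \<delta> - ln q / t" using elim by (simp add: field_simps)
    finally show ?case using elim by simp
  qed
qed

section \<open>The two large deviation bounds\<close>

lemma ereal_times_log_prob: "0 < p \<Longrightarrow> ereal c * log_prob p = ereal (c * ln p)"
  by (simp add: log_prob_def)

text \<open>For fixed \<delta>, the geometric constant contributes nothing on the scale
  \<open>1 / t\<close> and the normaliser contributes \<open>- m\<close>; then \<delta> tends to 0.
  A real level \<open>J\<close> stands in for the infimum, which may be infinite.\<close>

lemma LDP_upper:
  assumes J: "\<And>x. x \<in> C \<Longrightarrow> ereal J \<le> rate_A \<nu> lam x"
  shows "Limsup at_top (\<lambda>t. ereal (1 / t) *
      log_prob (measure (M t) {\<omega> \<in> space (M t). real (A t \<omega>) / t \<in> C})) \<le> ereal (- J)"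
    (is "Limsup at_top ?L \<le> _")
proof -
  have bound: "Limsup at_top ?L \<le> ereal ((1 - \<delta>) * (m - J) + 2 * m * \<delta> - m)"
    if \<delta>: "0 < \<delta>" "\<delta> \<le> 1" for \<delta>
  proof -
    define c where "c = (1 - \<delta>) * (m - J) + 2 * m * \<delta>"
    define q where "q = 1 - 2 powr - (\<nu> * \<delta>)"
    have q: "0 < q" using q_bounds[OF \<delta>(1)] by (simp add: q_def)
    have inv: "((\<lambda>t. ln q / t) \<longlongrightarrow> 0) at_top" by real_asymp
    have "((\<lambda>t. c - ln q / t - ln (E t) / t) \<longlongrightarrow> c - 0 - m) at_top"
      by (intro tendsto_diff tendsto_const inv ln_E_asymp)
    then have lim: "((\<lambda>t. ereal (c - ln q / t - ln (E t) / t)) \<longlongrightarrow> ereal (c - m)) at_top"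
      by simp
    have "\<forall>\<^sub>F t in at_top. ?L t \<le> ereal (c - ln q / t - ln (E t) / t)"
      using eventually_gt_at_top[of 0]
    proof eventually_elim
      case (elim t)
      define p where "p = measure (M t) {\<omega> \<in> space (M t). real (A t \<omega>) / t \<in> C}"
      have "p \<le> exp (t * c) / q / E t"
        unfolding p_def c_def q_def
        using prob_le[OF elim \<delta>, of "{k. real k / t \<in> C}" J] J elim
        by (force simp: rate_A_eq)
      moreover have "0 \<le> p" by (simp add: p_def)
      ultimately show ?case
        unfolding p_def[symmetric]
      \<comment> \<open>For \<open>p = 0\<close> the left side is \<open>-\<infinity>\<close>, since
        \<open>1 / t > 0\<close>.\<close>
      proof (cases "p = 0")
        case False
        with \<open>0 \<le> p\<close> have p: "0 < p" by simp
        have "ln p \<le> ln (exp (t * c) / q / E t)"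
          using \<open>p \<le> _\<close> p q E_pos[OF elim] by (subst ln_le_cancel_iff) auto
        also have "\<dots> = t * c - ln q - ln (E t)"
          using q E_pos[OF elim] by (simp add: ln_div ln_mult)
        finally have "ln p / t \<le> (t * c - ln q - ln (E t)) / t"
          using elim by (intro divide_right_mono) auto
        also have "\<dots> = c - ln q / t - ln (E t) / t" using elim by (simp add: field_simps)
        finally show "ereal (1 / t) * log_prob p \<le> ereal (c - ln q / t - ln (E t) / t)"
          using p by (simp add: ereal_times_log_prob)
      qed (use elim in \<open>simp add: log_prob_def\<close>)
    qed
    then have "Limsup at_top ?L \<le> Limsup at_top (\<lambda>t. ereal (c - ln q / t - ln (E t) / t))"
      by (rule Limsup_mono)
    also have "\<dots> = ereal (c - m)" using lim by (intro lim_imp_Limsup) auto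
    finally show ?thesis by (simp add: c_def)
  qed
  have "((\<lambda>\<delta>. (1 - \<delta>) * (m - J) + 2 * m * \<delta> - m) \<longlongrightarrow> (1 - 0) * (m - J) + 2 * m * 0 - m) (at_right 0)"
    by (intro tendsto_intros)
  then have "((\<lambda>\<delta>. ereal ((1 - \<delta>) * (m - J) + 2 * m * \<delta> - m)) \<longlongrightarrow> ereal (- J)) (at_right 0)"
    by simp
  moreover have "\<forall>\<^sub>F \<delta> in at_right (0::real).
      Limsup at_top ?L \<le> ereal ((1 - \<delta>) * (m - J) + 2 * m * \<delta> - m)"
    using eventually_at_right_less[of 0] eventually_at_right_real[of 0 1]
    by (auto elim!: eventually_mono intro: bound)
  ultimately show ?thesis
    by (intro tendsto_lowerbound[where F = "at_right (0::real)"]) auto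
qed

text \<open>The value \<open>k = \<lfloor>x * t\<rfloor>\<close> satisfies
  \<open>real k / t \<in> G\<close> for large \<open>t\<close>, so the probability of this one value
  is a lower bound.\<close>

lemma LDP_lower:
  assumes "open G" "x \<in> G" "0 \<le> x"
  shows "ereal (- f x) \<le> Liminf at_top (\<lambda>t. ereal (1 / t) *
      log_prob (measure (M t) {\<omega> \<in> space (M t). real (A t \<omega>) / t \<in> G}))"
    (is "_ \<le> Liminf at_top ?L")
proof -
  have "\<exists>h. (h \<longlongrightarrow> m - f x) at_top \<and> (\<forall>\<^sub>F t in at_top. h t \<le> ln (w t (nat \<lfloor>x * t\<rfloor>)) / t)"
  \<comment> \<open>At \<open>x = 0\<close> the selected weight is \<open>w t 0 = 1\<close>, so
    \<open>h = 0\<close> works because \<open>f 0 = m\<close>; \<open>ln_w_floor_lower\<close>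
    covers only \<open>x > 0\<close>.\<close>
  proof (cases "x = 0")
    case True
    have "\<forall>\<^sub>F t in at_top. 0 \<le> ln (w t (nat \<lfloor>x * t\<rfloor>)) / t"
      using eventually_gt_at_top[of 0] by eventually_elim (use True in \<open>simp add: w_0\<close>)
    then show ?thesis using True by (intro exI[of _ "\<lambda>_. 0"]) (simp add: f_def)
  qed (use assms ln_w_floor_lower in auto)
  then obtain h where h: "(h \<longlongrightarrow> m - f x) at_top"
      "\<forall>\<^sub>F t in at_top. h t \<le> ln (w t (nat \<lfloor>x * t\<rfloor>)) / t"
    by blast
  have "((\<lambda>t. h t - ln (E t) / t) \<longlongrightarrow> m - f x - m) at_top"
    by (intro tendsto_diff h ln_E_asymp)
  then have lim: "((\<lambda>t. ereal (h t - ln (E t) / t)) \<longlongrightarrow> ereal (- f x)) at_top" by simp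
  have "\<forall>\<^sub>F t in at_top. real_of_int \<lfloor>x * t\<rfloor> / t \<in> G"
    using assms by (intro topological_tendstoD[OF floor_mult_over_tendsto])
  with h(2) eventually_gt_at_top[of 0]
  have "\<forall>\<^sub>F t in at_top. ereal (h t - ln (E t) / t) \<le> ?L t"
  proof eventually_elim
    case (elim t)
    interpret prob_space "M t" using elim prob_space_M by simp
    have [measurable]: "A t \<in> measurable (M t) (count_space UNIV)" using elim A_measurable by simp
    define k where "k = nat \<lfloor>x * t\<rfloor>"
    define p where "p = measure (M t) {\<omega> \<in> space (M t). real (A t \<omega>) / t \<in> G}"
    have "real k / t \<in> G" using elim assms by (simp add: k_def)
    moreover have "{\<omega> \<in> space (M t). real (A t \<omega>) / t \<in> G} \<in> sets (M t)"
      using measurable_sets[OF \<open>A t \<in> _\<close>, of "{k. real k / t \<in> G}"]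
      by (simp add: vimage_def Int_def conj_commute)
    ultimately have "measure (M t) {\<omega> \<in> space (M t). A t \<omega> = k} \<le> p"
      unfolding p_def by (intro finite_measure_mono) auto
    then have wp: "w t k / E t \<le> p" using prob_eq[of t k] elim by simp
    have pos: "0 < w t k / E t" using elim w_pos E_pos by simp
    then have p: "0 < p" using wp by linarith
    have "ln (w t k) - ln (E t) = ln (w t k / E t)" using elim w_pos[of t k] E_pos[of t] by (simp add: ln_div)
    also have "\<dots> \<le> ln p" using wp p pos by (subst ln_le_cancel_iff) auto
    finally have "(ln (w t k) - ln (E t)) / t \<le> ln p / t" using elim by (intro divide_right_mono) auto
    then have "h t - ln (E t) / t \<le> ln p / t" using elim by (simp add: k_def diff_divide_distrib)
    then show ?case unfolding p_def[symmetric] using p by (simp add: ereal_times_log_prob)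
  qed
  then have "Liminf at_top (\<lambda>t. ereal (h t - ln (E t) / t)) \<le> Liminf at_top ?L"
    by (rule Liminf_mono)
  moreover have "Liminf at_top (\<lambda>t. ereal (h t - ln (E t) / t)) = ereal (- f x)"
    using lim by (intro lim_imp_Liminf) auto
  ultimately show ?thesis by simp
qed

section \<open>Assembly of the large deviation principle\<close>

theorem LDP: "satisfies_LDP M (\<lambda>t \<omega>. real (A t \<omega>) / t) (rate_A \<nu> lam)"
  unfolding satisfies_LDP_def
proof (intro conjI allI impI)
  fix t :: real assume "0 < t"
  then have [measurable]: "A t \<in> measurable (M t) (count_space UNIV)" by (rule A_measurable)
  show "(\<lambda>\<omega>. real (A t \<omega>) / t) \<in> borel_measurable (M t)" by measurable
next
  fix C :: "real set"
  let ?P = "\<lambda>t. ereal (1 / t) * log_prob (measure (M t) {\<omega> \<in> space (M t). real (A t \<omega>) / t \<in> C})"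
  \<comment> \<open>Approximating the infimum from below by real levels also covers the value
    \<infinity>, as for \<open>C\<close> inside the negative axis.\<close>
  have "(INF x\<in>C. rate_A \<nu> lam x) \<le> - Limsup at_top ?P"
  proof (rule dense_le)
    fix z assume z: "z < (INF x\<in>C. rate_A \<nu> lam x)"
    show "z \<le> - Limsup at_top ?P"
    proof (cases z)
      case (real J)
      have "ereal J \<le> rate_A \<nu> lam x" if "x \<in> C" for x
        using less_le_trans[OF z INF_lower[OF that]] real by simp
      then have "Limsup at_top ?P \<le> - z"
        using LDP_upper real by simp
      then have "- (- z) \<le> - Limsup at_top ?P"
        by (simp only: ereal_minus_le_minus)
      then show ?thesis by simp
    qed (use z in auto)
  qed
  then have "- (- Limsup at_top ?P) \<le> - (INF x\<in>C. rate_A \<nu> lam x)"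
    by (simp only: ereal_minus_le_minus)
  then show "Limsup at_top ?P \<le> - (INF x\<in>C. rate_A \<nu> lam x)" by simp
next
  fix G :: "real set" assume G: "open G"
  let ?P = "\<lambda>t. ereal (1 / t) * log_prob (measure (M t) {\<omega> \<in> space (M t). real (A t \<omega>) / t \<in> G})"
  have "- Liminf at_top ?P \<le> (INF x\<in>G. rate_A \<nu> lam x)"
  proof (rule INF_greatest)
    fix x assume "x \<in> G"
    \<comment> \<open>For \<open>x < 0\<close> the right side is \<infinity>; otherwise
      \<open>LDP_lower\<close> applies.\<close>
    then show "- Liminf at_top ?P \<le> rate_A \<nu> lam x"
      using LDP_lower[OF G, of x] by (auto simp: rate_A_eq ereal_uminus_le_reorder)
  qed
  then show "- (INF x\<in>G. rate_A \<nu> lam x) \<le> Liminf at_top ?P"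
    by (simp add: ereal_uminus_le_reorder)
next
  show "0 \<le> rate_A \<nu> lam x" for x
    by (simp add: rate_A_eq f_nonneg)
qed (fact prob_space_M lower_semicontinuous_rate)+

end

theorem proposition4p1:
  fixes \<nu> lam :: real
    and M :: "real \<Rightarrow> 'w measure"
    and A :: "real \<Rightarrow> 'w \<Rightarrow> nat"
  assumes "0 < \<nu>" and "\<nu> \<le> 1" and "0 < lam"
    and "\<And>t. 0 < t \<Longrightarrow> prob_space (M t)"
    and "\<And>t. 0 < t \<Longrightarrow> A t \<in> measurable (M t) (count_space UNIV)"
    and "\<And>t k. 0 < t \<Longrightarrow>
           measure (M t) {\<omega> \<in> space (M t). A t \<omega> = k} =
             (lam * t powr \<nu>) ^ k / Gamma (\<nu> * real k + 1)
               * (1 / mittag_leffler \<nu> 1 (lam * t powr \<nu>))"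
  shows "satisfies_LDP M (\<lambda>t \<omega>. real (A t \<omega>) / t) (rate_A \<nu> lam)
         \<and> good_rate_function (rate_A \<nu> lam)"
proof -
  interpret mittag_leffler_family \<nu> lam M A
    by (rule mittag_leffler_family.intro) (fact assms)+
  show ?thesis using LDP good_rate by blast
qed

end
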